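(* Let $Y\in\mathbb R^n$ and let $X\in\mathbb R^{n\times p}$ have rank $r$. Set $\bar Z=X^\top Y$ and $\bar R=X^\top X$. Then the standard formulation, the projected formulation and the recursive formulation of LARS (Algorithms A, B and C of the context), run on the input $(\bar Z,\bar R)$, output the same sequence $((\lambda_k,\bar\imath_k,\varepsilon_k))_{k=1}^r$, where $\lambda_1\ge\lambda_2\ge\cdots\ge0$ are the knots and $\bar\imath_1,\ldots,\bar\imath_r$ are the variables entering the model with signs $\varepsilon_1,\ldots,\varepsilon_r\in\{\pm1\}$.
   Context: $[m]=\{1,\ldots,m\}$. It is understood that, at every step $k\le r$, the maxima below are attained at a unique index and the knots are positive, so that the algorithms are well defined. An element $i\in[2p]$ encodes $j\in[p]$ and $s\in\{\pm1\}$ by $i=j+p\frac{1-s}{2}$; when an algorithm produces $\hat\imath_k\in[2p]$, then $\bar\imath_k\in[p]$ is the representative of $\hat\imath_k$ modulo $p$ and $\varepsilon_k=1-2(\hat\imath_k-\bar\imath_k)/p$. In B and C, $Z=(\bar Z,-\bar Z)\in\mathbb R^{2p}$ and $R=\begin{pmatrix}\bar R&-\bar R\\-\bar R&\bar R\end{pmatrix}$. Algorithm A (standard). Set $\lambda_1=\max_j|\bar Z_j|$, $\bar\imath_1=\arg\max_j|\bar Z_j|$, $\varepsilon_1=\bar Z_{\bar\imath_1}/\lambda_1$, $\bar N^{(1)}=\bar Z$. For $k\ge2$: let $\bar M$ be the submatrix of $\bar R$ indexed by $\bar\imath_1,\ldots,\bar\imath_{k-1}$ and, for $j\in[p]$,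 $\bar\theta_j=(\bar R_{j,\bar\imath_1}\cdots\bar R_{j,\bar\imath_{k-1}})\bar M^{-1}(\varepsilon_1,\ldots,\varepsilon_{k-1})^\top$; for $0<\lambda\le\lambda_{k-1}$ put $\bar N_j^{(k)}(\lambda)=\bar N_j^{(k-1)}-(\lambda_{k-1}-\lambda)\bar\theta_j$; then $\lambda_k=\max\{\beta\in(0,\lambda_{k-1}]:\exists j\notin\{\bar\imath_1,\ldots,\bar\imath_{k-1}\},\ |\bar N_j^{(k)}(\beta)|=\beta\}$, $\bar\imath_k=\arg\max_{j\notin\{\bar\imath_1,\ldots,\bar\imath_{k-1}\}}|\bar N_j^{(k)}(\lambda_k)|$, $\varepsilon_k=\bar N^{(k)}_{\bar\imath_k}(\lambda_k)/\lambda_k$, $\bar N^{(k)}=\bar N^{(k)}(\lambda_k)$. Algorithm B (projected). $\lambda_1=\max_jZ_j$, $\hat\imath_1=\arg\max_jZ_j$. For $k\ge2$: let $M$ be the submatrix of $R$ indexed by $\hat\imath_1,\ldots,\hat\imath_{k-1}$, $\theta_j=(R_{j,\hat\imath_1}\cdots R_{j,\hat\imath_{k-1}})M^{-1}(1,\ldots,1)^\top$, $\Pi(Z_j)=(R_{j,\hat\imath_1}\cdots R_{j,\hat\imath_{k-1}})M^{-1}(Z_{\hat\imath_1},\ldots,Z_{\hat\imath_{k-1}})^\top$ for $j\in[2p]$; then $\lambda_k$ and $\hat\imath_k$ are the maximum and argmax of $\frac{Z_j-\Pi(Z_j)}{1-\theta_j}$ over $\{j\in[2p]:\theta_j<1\}$.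 Algorithm C (recursive). Define $\mathrm{Rec}(R,Z,T)$, for a symmetric positive semidefinite matrix $R$ and vectors $Z,T$, as follows: $\lambda$ and $\mathbf i$ are the maximum and argmax of $Z_j/(1-T_j)$ over $\{j:T_j<1\}$; $\mathbf x=R_{\mathbf i}/R_{\mathbf i\mathbf i}$, where $R_{\mathbf i}$ is the $\mathbf i$-th column of $R$; return $(R-\mathbf xR_{\mathbf i}^\top,\ Z-\mathbf xZ_{\mathbf i},\ T+\mathbf x(1-T_{\mathbf i}),\ \lambda,\ \mathbf i)$. Start from $R=\begin{pmatrix}\bar R&-\bar R\\-\bar R&\bar R\end{pmatrix}$, $Z=(\bar Z,-\bar Z)\in\mathbb R^{2p}$ and $T=0\in\mathbb R^{2p}$, and for $k=1,2,\ldots$ set $(R,Z,T,\lambda_k,\hat\imath_k)=\mathrm{Rec}(R,Z,T)$. *)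

theory Defs
  imports
    "Jordan_Normal_Form.Gauss_Jordan_Elimination"
    "Jordan_Normal_Form.DL_Rank"
begin

(*
  Conventions.  Variables are numbered from 0: the variables are the j < p and the signed
  variables are the i < 2p, where i = j + p * (1 - s) / 2 encodes (j, s), s = 1 or s = -1.
  Steps are numbered from 1.  An argmax is arg_max_on, a maximum over a finite set is Max, and the
  maximum of the (a priori infinite) set of hitting levels is Greatest.  These operators are
  total; the well-definedness predicates say when they denote what is meant.
*)

definition unique_arg_max_on :: "(nat \<Rightarrow> real) \<Rightarrow> nat set \<Rightarrow> bool" where
  "unique_arg_max_on f S \<longleftrightarrow> (\<exists>!i. is_arg_max f (\<lambda>j. j \<in> S) i)"

definition signed_var :: "nat \<Rightarrow> nat \<Rightarrow> nat" where
  "signed_var p i = i mod p"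

definition signed_sgn :: "nat \<Rightarrow> nat \<Rightarrow> real" where
  "signed_sgn p i = 1 - 2 * (real i - real (signed_var p i)) / real p"

definition signed_corr :: "real vec \<Rightarrow> real vec" where
  "signed_corr Z = Z @\<^sub>v (- Z)"

definition signed_gram :: "real mat \<Rightarrow> real mat" where
  "signed_gram R = four_block_mat R (- R) (- R) R"

(* The rows and columns follow the order of entry in the list, which need not be increasing. *)
definition active_mat :: "real mat \<Rightarrow> nat list \<Rightarrow> real mat" where
  "active_mat R is = mat (length is) (length is) (\<lambda>(a, b). R $$ (is ! a, is ! b))"

definition active_row :: "real mat \<Rightarrow> nat list \<Rightarrow> nat \<Rightarrow> real vec" where
  "active_row R is j = vec (length is) (\<lambda>b. R $$ (j, is ! b))"

(* (R_{j,i_1} ... R_{j,i_m}) M^{-1} v, where is = [i_1, ..., i_m].  The value of mat_inverse is None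
   for a singular M; regularity of M is not among the hypotheses below but follows from them. *)
definition regress :: "real mat \<Rightarrow> nat list \<Rightarrow> real vec \<Rightarrow> nat \<Rightarrow> real" where
  "regress R is v j = active_row R is j \<bullet> (the (mat_inverse (active_mat R is)) *\<^sub>v v)"


subsection \<open>Standard formulation\<close>

datatype std_state =
  Std (std_knot: real) (std_active: "nat list") (std_signs: "real list") (std_corr: "real vec")

definition std_first :: "real vec \<Rightarrow> std_state" where
  "std_first Z =
    (let lam = Max ((\<lambda>j. \<bar>Z $ j\<bar>) ` {..<dim_vec Z});
         i = arg_max_on (\<lambda>j. \<bar>Z $ j\<bar>) {..<dim_vec Z}
     in Std lam [i] [Z $ i / lam] Z)"

definition std_inactive :: "std_state \<Rightarrow> nat set" where
  "std_inactive s = {..<dim_vec (std_corr s)} - set (std_active s)"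

definition std_theta :: "real mat \<Rightarrow> std_state \<Rightarrow> nat \<Rightarrow> real" where
  "std_theta R s j = regress R (std_active s) (vec_of_list (std_signs s)) j"

definition std_path :: "real mat \<Rightarrow> std_state \<Rightarrow> real \<Rightarrow> real vec" where
  "std_path R s lam =
    vec (dim_vec (std_corr s)) (\<lambda>j. std_corr s $ j - (std_knot s - lam) * std_theta R s j)"

definition std_hits :: "real mat \<Rightarrow> std_state \<Rightarrow> real set" where
  "std_hits R s =
    {\<beta>. 0 < \<beta> \<and> \<beta> \<le> std_knot s \<and> (\<exists>j \<in> std_inactive s. \<bar>std_path R s \<beta> $ j\<bar> = \<beta>)}"

definition std_next_knot :: "real mat \<Rightarrow> std_state \<Rightarrow> real" where
  "std_next_knot R s = (GREATEST \<beta>. \<beta> \<in> std_hits R s)"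

definition std_step :: "real mat \<Rightarrow> std_state \<Rightarrow> std_state" where
  "std_step R s =
    (let lam = std_next_knot R s;
         N = std_path R s lam;
         i = arg_max_on (\<lambda>j. \<bar>N $ j\<bar>) (std_inactive s)
     in Std lam (std_active s @ [i]) (std_signs s @ [N $ i / lam]) N)"

definition std_run :: "real mat \<Rightarrow> real vec \<Rightarrow> nat \<Rightarrow> std_state" where
  "std_run R Z k = (std_step R ^^ (k - 1)) (std_first Z)"

definition std_output :: "real mat \<Rightarrow> real vec \<Rightarrow> nat \<Rightarrow> real \<times> nat \<times> real" where
  "std_output R Z k =
    (let s = std_run R Z k in (std_knot s, last (std_active s), last (std_signs s)))"

definition std_well_defined_at :: "real mat \<Rightarrow> real vec \<Rightarrow> nat \<Rightarrow> bool" where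
  "std_well_defined_at R Z k \<longleftrightarrow>
    0 < std_knot (std_run R Z k) \<and>
    (if k = 1 then unique_arg_max_on (\<lambda>j. \<bar>Z $ j\<bar>) {..<dim_vec Z}
     else let s = std_run R Z (k - 1) in
       (\<exists>\<beta> \<in> std_hits R s. \<forall>\<gamma> \<in> std_hits R s. \<gamma> \<le> \<beta>) \<and>
       unique_arg_max_on (\<lambda>j. \<bar>std_path R s (std_next_knot R s) $ j\<bar>) (std_inactive s))"

definition std_well_defined :: "real mat \<Rightarrow> real vec \<Rightarrow> nat \<Rightarrow> bool" where
  "std_well_defined R Z r \<longleftrightarrow> (\<forall>k \<in> {1..r}. std_well_defined_at R Z k)"


subsection \<open>Projected formulation\<close>

(* Up to proj_run and in proj_well_defined_at, R and Z are the signed Gram matrix and correlation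
   vector, of dimension 2p; proj_output and proj_well_defined take the unsigned input.  A state is
   the current knot with the list of the signed variables selected so far. *)

definition proj_first :: "real vec \<Rightarrow> real \<times> nat list" where
  "proj_first Z =
    (Max ((\<lambda>j. Z $ j) ` {..<dim_vec Z}), [arg_max_on (\<lambda>j. Z $ j) {..<dim_vec Z}])"

definition proj_theta :: "real mat \<Rightarrow> nat list \<Rightarrow> nat \<Rightarrow> real" where
  "proj_theta R is j = regress R is (vec (length is) (\<lambda>_. 1)) j"

definition proj_corr :: "real mat \<Rightarrow> real vec \<Rightarrow> nat list \<Rightarrow> nat \<Rightarrow> real" where
  "proj_corr R Z is j = regress R is (vec (length is) (\<lambda>a. Z $ (is ! a))) j"

definition proj_cands :: "real mat \<Rightarrow> real vec \<Rightarrow> nat list \<Rightarrow> nat set" where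
  "proj_cands R Z is = {j. j < dim_vec Z \<and> proj_theta R is j < 1}"

definition proj_ratio :: "real mat \<Rightarrow> real vec \<Rightarrow> nat list \<Rightarrow> nat \<Rightarrow> real" where
  "proj_ratio R Z is j = (Z $ j - proj_corr R Z is j) / (1 - proj_theta R is j)"

definition proj_step :: "real mat \<Rightarrow> real vec \<Rightarrow> real \<times> nat list \<Rightarrow> real \<times> nat list" where
  "proj_step R Z s =
    (let is = snd s
     in (Max (proj_ratio R Z is ` proj_cands R Z is),
         is @ [arg_max_on (proj_ratio R Z is) (proj_cands R Z is)]))"

definition proj_run :: "real mat \<Rightarrow> real vec \<Rightarrow> nat \<Rightarrow> real \<times> nat list" where
  "proj_run R Z k = (proj_step R Z ^^ (k - 1)) (proj_first Z)"

definition proj_output :: "real mat \<Rightarrow> real vec \<Rightarrow> nat \<Rightarrow> real \<times> nat \<times> real" where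
  "proj_output R Z k =
    (let p = dim_vec Z;
         s = proj_run (signed_gram R) (signed_corr Z) k;
         i = last (snd s)
     in (fst s, signed_var p i, signed_sgn p i))"

definition proj_well_defined_at :: "real mat \<Rightarrow> real vec \<Rightarrow> nat \<Rightarrow> bool" where
  "proj_well_defined_at R Z k \<longleftrightarrow>
    0 < fst (proj_run R Z k) \<and>
    (if k = 1 then unique_arg_max_on (\<lambda>j. Z $ j) {..<dim_vec Z}
     else let is = snd (proj_run R Z (k - 1)) in
       unique_arg_max_on (proj_ratio R Z is) (proj_cands R Z is))"

definition proj_well_defined :: "real mat \<Rightarrow> real vec \<Rightarrow> nat \<Rightarrow> bool" where
  "proj_well_defined R Z r \<longleftrightarrow>
    (\<forall>k \<in> {1..r}. proj_well_defined_at (signed_gram R) (signed_corr Z) k)"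


subsection \<open>Recursive formulation\<close>

definition rec_cands :: "real vec \<Rightarrow> nat set" where
  "rec_cands T = {j. j < dim_vec T \<and> T $ j < 1}"

definition rec_ratio :: "real vec \<Rightarrow> real vec \<Rightarrow> nat \<Rightarrow> real" where
  "rec_ratio Z T j = Z $ j / (1 - T $ j)"

definition rec_knot :: "real mat \<times> real vec \<times> real vec \<Rightarrow> real" where
  "rec_knot = (\<lambda>(R, Z, T). Max (rec_ratio Z T ` rec_cands T))"

definition rec_index :: "real mat \<times> real vec \<times> real vec \<Rightarrow> nat" where
  "rec_index = (\<lambda>(R, Z, T). arg_max_on (rec_ratio Z T) (rec_cands T))"

definition outer :: "real vec \<Rightarrow> real vec \<Rightarrow> real mat" where
  "outer v w = mat (dim_vec v) (dim_vec w) (\<lambda>(a, b). v $ a * w $ b)"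

(* One call of Rec returns rec_update together with rec_knot and rec_index. *)
definition rec_update ::
    "real mat \<times> real vec \<times> real vec \<Rightarrow> real mat \<times> real vec \<times> real vec" where
  "rec_update = (\<lambda>(R, Z, T).
    (let i = rec_index (R, Z, T);
         x = (1 / R $$ (i, i)) \<cdot>\<^sub>v col R i
     in (R - outer x (col R i), Z - (Z $ i) \<cdot>\<^sub>v x, T + (1 - T $ i) \<cdot>\<^sub>v x)))"

(* The argument of the k-th call of Rec. *)
definition rec_arg :: "real mat \<Rightarrow> real vec \<Rightarrow> nat \<Rightarrow> real mat \<times> real vec \<times> real vec" where
  "rec_arg R Z k =
    (rec_update ^^ (k - 1)) (signed_gram R, signed_corr Z, 0\<^sub>v (2 * dim_vec Z))"

definition rec_output :: "real mat \<Rightarrow> real vec \<Rightarrow> nat \<Rightarrow> real \<times> nat \<times> real" where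
  "rec_output R Z k =
    (let p = dim_vec Z;
         s = rec_arg R Z k;
         i = rec_index s
     in (rec_knot s, signed_var p i, signed_sgn p i))"

definition rec_well_defined :: "real mat \<Rightarrow> real vec \<Rightarrow> nat \<Rightarrow> bool" where
  "rec_well_defined R Z r \<longleftrightarrow>
    (\<forall>k \<in> {1..r}. case rec_arg R Z k of (R', Z', T') \<Rightarrow>
      0 < rec_knot (R', Z', T') \<and> unique_arg_max_on (rec_ratio Z' T') (rec_cands T'))"

end

theory Submission
  imports Defs
begin

text \<open>
  All three algorithms follow the same path \<open>N(\<lambda>) = Z - \<Pi>(Z) + \<lambda> \<theta>\<close> of
  correlations with the residual. On the active set \<open>N(\<lambda>)\<close> equals \<open>\<lambda>\<close> times
  the signs, and it differs from \<open>Z\<close> by a combination of the active columns of \<open>R\<close>; as long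
  as the active submatrix is regular, these two properties determine \<open>N(\<lambda>)\<close>. The formulations
  differ only in the way in which they find the level at which the next variable reaches the boundary
  \<open>\<bar>N\<^sub>j(\<lambda>)\<bar> = \<lambda>\<close>.

  Standard against projected. Doubling the variables with both signs turns \<open>\<bar>N\<^sub>j(\<lambda>)\<bar> =
  \<lambda>\<close> into \<open>N\<^sub>i(\<lambda>) = \<lambda>\<close> for a signed variable \<open>i\<close>, whose
  path is a line with slope \<open>\<theta>\<^sub>i\<close> and offset \<open>Z\<^sub>i - \<Pi>(Z\<^sub>i)\<close>.
  For an inactive \<open>i\<close> this line is strictly below the diagonal at the current knot, so when the level
  decreases it meets the diagonal only if \<open>\<theta>\<^sub>i < 1\<close>, and then at the ratio \<open>(Z\<^sub>i
  - \<Pi>(Z\<^sub>i)) / (1 - \<theta>\<^sub>i)\<close>. For an active variable the offset vanishes, so the negative of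
  an active variable contributes only the ratio 0. Hence the levels at which a variable is hit are exactly the
  positive ratios (lemma \<open>std_hits_eq\<close>), and the first level hit is the maximal ratio.

  Regularity of the active submatrix. A variable that depends linearly on the active ones has offset 0, because the
  offset is its inner product with the part of \<open>Y\<close> orthogonal to the active columns. If it reached the
  boundary at one level it would be there at every level, in particular at the previous knot, where a unique maximum
  had been attained by another variable (lemma \<open>regular_append\<close>).

  Projected against recursive. One call of Rec is one step of Gaussian elimination: its pivot is a Schur complement,
  and adding one node to an interpolation is a rank-one correction (lemma \<open>fitted_append\<close>). Consequently
  the vectors kept by Rec are \<open>Z - \<Pi>(Z)\<close> and \<open>\<theta>\<close>, and its ratios are those of the
  projected formulation.

  The predicate \<open>common_state\<close> collects what the three states have in common after each step; the theorem
  is the induction over the steps.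
\<close>
section \<open>Interpolation by columns of a matrix\<close>

definition combination :: "real mat \<Rightarrow> nat list \<Rightarrow> (nat \<Rightarrow> real) \<Rightarrow> nat \<Rightarrow> real" where
  "combination R is c j = (\<Sum>b<length is. c b * R $$ (j, is ! b))"

text \<open>
  Regularity of the active submatrix, stated as triviality of its kernel. In this form it can be handled without
  choosing an inverse, and appending an index only adds one summand.
\<close>
definition regular :: "real mat \<Rightarrow> nat list \<Rightarrow> bool" where
  "regular R is \<longleftrightarrow>
    (\<forall>c. (\<forall>i\<in>set is. combination R is c i = 0) \<longrightarrow> (\<forall>b<length is. c b = 0))"

text \<open>
  Seen as a function of \<open>j\<close>, this is the combination of the columns \<open>is\<close> that interpolates
  \<open>f\<close> at the nodes \<open>is\<close>. For signed variables, \<open>f = Z\<close> gives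
  \<open>\<Pi>(Z)\<close>, the constant 1 gives \<open>\<theta>\<close>, and a column of \<open>R\<close> gives the
  part that elimination removes from it. Taking \<open>f\<close> as a function of the variable, and not of the
  position in the list, makes these special cases of one linear operator.
\<close>
definition fitted :: "real mat \<Rightarrow> nat list \<Rightarrow> (nat \<Rightarrow> real) \<Rightarrow> nat \<Rightarrow> real" where
  "fitted R is f j = regress R is (vec (length is) (\<lambda>a. f (is ! a))) j"

lemma combination_append:
  "combination R (is @ [i]) c j = combination R is c j + c (length is) * R $$ (j, i)"
  by (simp add: combination_def nth_append)

lemma combination_linear:
  "combination R is (\<lambda>b. x * c b + y * d b) j = x * combination R is c j + y * combination R is d j"
  by (simp add: combination_def algebra_simps sum.distrib sum_distrib_left)

lemma combination_cong:
  "(\<And>b. b < length is \<Longrightarrow> c b = d b) \<Longrightarrow> combination R is c j = combination R is d j"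
  by (simp add: combination_def)

lemma fitted_cong:
  assumes "\<And>i. i \<in> set is \<Longrightarrow> f i = g i"
  shows "fitted R is f j = fitted R is g j"
proof -
  have "vec (length is) (\<lambda>a. f (is ! a)) = vec (length is) (\<lambda>a. g (is ! a))"
    using assms by (intro eq_vecI) auto
  then show ?thesis by (simp add: fitted_def)
qed

lemma regular_Nil [simp]: "regular R []"
  by (simp add: regular_def)

lemma mat_inverse_active_mat:
  assumes "regular R is"
  obtains B where "mat_inverse (active_mat R is) = Some B" "B \<in> carrier_mat (length is) (length is)"
    "active_mat R is * B = 1\<^sub>m (length is)"
proof -
  let ?k = "length is" and ?M = "active_mat R is"
  have M: "?M \<in> carrier_mat ?k ?k" by (simp add: active_mat_def)
  have "det ?M \<noteq> 0"
  proof
    assume "det ?M = 0"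
    then obtain v where v: "v \<in> carrier_vec ?k" "v \<noteq> 0\<^sub>v ?k" "?M *\<^sub>v v = 0\<^sub>v ?k"
      using det_0_iff_vec_prod_zero_field[OF M] by blast
    have "combination R is (\<lambda>b. v $ b) (is ! a) = 0" if a: "a < ?k" for a
    proof -
      have "combination R is (\<lambda>b. v $ b) (is ! a) = (?M *\<^sub>v v) $ a"
        using v(1) a
        by (auto simp: combination_def active_mat_def scalar_prod_def atLeast0LessThan mult.commute
            intro!: sum.cong)
      then show ?thesis using v(3) a by simp
    qed
    then have "\<forall>i\<in>set is. combination R is (\<lambda>b. v $ b) i = 0"
      by (auto simp: in_set_conv_nth)
    then have "\<forall>b<?k. v $ b = 0" using assms unfolding regular_def by blast
    then have "v = 0\<^sub>v ?k" using v(1) by (intro eq_vecI) auto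
    then show False using v(2) by simp
  qed
  then have "?M \<in> Units (ring_mat TYPE(real) ?k ())" by (rule det_non_zero_imp_unit[OF M])
  then obtain B where "mat_inverse ?M = Some B" using mat_inverse(1)[OF M, where b = "()"] by blast
  then show ?thesis using mat_inverse(2)[OF M] that by blast
qed

lemma fitted_is_combination:
  assumes "regular R is"
  obtains c where "\<And>j. fitted R is f j = combination R is c j"
    "\<And>i. i \<in> set is \<Longrightarrow> combination R is c i = f i"
proof -
  let ?k = "length is" and ?M = "active_mat R is" and ?v = "vec (length is) (\<lambda>a. f (is ! a))"
  obtain B where B: "mat_inverse ?M = Some B" "B \<in> carrier_mat ?k ?k" "?M * B = 1\<^sub>m ?k"
    using mat_inverse_active_mat[OF assms] .
  have M: "?M \<in> carrier_mat ?k ?k" by (simp add: active_mat_def)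
  define w where "w = B *\<^sub>v ?v"
  have w: "w \<in> carrier_vec ?k" using B(2) by (simp add: w_def)
  have Mw: "?M *\<^sub>v w = ?v"
  proof -
    have "?M *\<^sub>v w = (?M * B) *\<^sub>v ?v"
      unfolding w_def by (rule assoc_mult_mat_vec[symmetric, OF M B(2)]) simp
    then show ?thesis using B(3) by simp
  qed
  show ?thesis
  proof (rule that[of "\<lambda>b. w $ b"])
    fix j
    show "fitted R is f j = combination R is (\<lambda>b. w $ b) j"
      using w by (simp add: fitted_def regress_def B(1) w_def[symmetric] combination_def
          active_row_def scalar_prod_def atLeast0LessThan mult.commute)
  next
    fix i assume "i \<in> set is"
    then obtain a where a: "a < ?k" "i = is ! a" by (auto simp: in_set_conv_nth)
    have "combination R is (\<lambda>b. w $ b) (is ! a) = (?M *\<^sub>v w) $ a"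
      using w a
      by (auto simp: combination_def active_mat_def scalar_prod_def atLeast0LessThan mult.commute
          intro!: sum.cong)
    then show "combination R is (\<lambda>b. w $ b) i = f i" using Mw a by simp
  qed
qed

lemma fitted_Nil [simp]: "fitted R [] f j = 0"
proof -
  obtain c where "\<And>j. fitted R [] f j = combination R [] c j"
    using fitted_is_combination[OF regular_Nil, of R f] by blast
  then show ?thesis by (simp add: combination_def)
qed

lemma combination_unique:
  assumes "regular R is" "\<And>i. i \<in> set is \<Longrightarrow> combination R is c i = combination R is d i"
  shows "combination R is c j = combination R is d j"
proof -
  have "\<forall>i\<in>set is. combination R is (\<lambda>b. 1 * c b + (-1) * d b) i = 0"
    unfolding combination_linear using assms(2) by simp
  then have "\<forall>b<length is. 1 * c b + (-1) * d b = 0"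
    using assms(1) unfolding regular_def by blast
  then show ?thesis by (intro combination_cong) simp
qed

text \<open>
  Interpolants are unique, so a fitted value can be computed by exhibiting any combination of the columns with the
  right values at the nodes. The later identities for fitted values are obtained in this way, without touching the
  inverse matrix.
\<close>
lemma fitted_eq_combination:
  assumes "regular R is" "\<And>i. i \<in> set is \<Longrightarrow> combination R is c i = f i"
  shows "fitted R is f j = combination R is c j"
proof -
  obtain d where d: "\<And>j. fitted R is f j = combination R is d j"
    "\<And>i. i \<in> set is \<Longrightarrow> combination R is d i = f i"
    using fitted_is_combination[OF assms(1)] by metis
  show ?thesis unfolding d(1)
    by (rule combination_unique[OF assms(1)]) (simp add: d(2) assms(2))
qed

lemma fitted_on_active: "regular R is \<Longrightarrow> i \<in> set is \<Longrightarrow> fitted R is f i = f i"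
  using fitted_is_combination[of R "is" f] by metis

lemma fitted_linear:
  assumes "regular R is"
  shows "fitted R is (\<lambda>i. x * f i + y * g i) j = x * fitted R is f j + y * fitted R is g j"
proof -
  obtain c where c: "\<And>j. fitted R is f j = combination R is c j"
    "\<And>i. i \<in> set is \<Longrightarrow> combination R is c i = f i"
    using fitted_is_combination[OF assms] by metis
  obtain d where d: "\<And>j. fitted R is g j = combination R is d j"
    "\<And>i. i \<in> set is \<Longrightarrow> combination R is d i = g i"
    using fitted_is_combination[OF assms] by metis
  show ?thesis unfolding c d combination_linear[symmetric]
    by (rule fitted_eq_combination[OF assms]) (simp add: combination_linear c(2) d(2))
qed

text \<open>
  The rank-one update behind block inversion: the correction is the part of column \<open>i\<close> that the old nodes
  do not explain, scaled to equal 1 at \<open>i\<close> (it vanishes at the old nodes), times the error of the old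
  interpolant at \<open>i\<close>. If \<open>f\<close> is already interpolated at \<open>i\<close>, nothing changes.
\<close>
lemma fitted_append:
  fixes R i "is"
  defines "g \<equiv> (\<lambda>a. R $$ (a, i))"
  assumes "regular R is" "regular R (is @ [i])"
  shows "fitted R (is @ [i]) f j = fitted R is f j
        + (f i - fitted R is f i) * ((g j - fitted R is g j) / (g i - fitted R is g i))"
proof -
  let ?k = "length is"
  obtain c where c: "\<And>j. fitted R is f j = combination R is c j"
    "\<And>i. i \<in> set is \<Longrightarrow> combination R is c i = f i"
    using fitted_is_combination[OF assms(2)] by metis
  obtain d where d: "\<And>j. fitted R is g j = combination R is d j"
    "\<And>i. i \<in> set is \<Longrightarrow> combination R is d i = g i"
    using fitted_is_combination[OF assms(2)] by metis
  \<comment> \<open>\<open>u y\<close> are the coefficients of the old interpolant of \<open>f\<close> plus \<open>y\<close> times the unexplained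
    part of the new column.\<close>
  define u where "u y = (\<lambda>b. if b < ?k then c b - y * d b else y)" for y
  have u: "combination R (is @ [i]) (u y) j = fitted R is f j + y * (g j - fitted R is g j)" for y j
  proof -
    have "combination R is (u y) j = combination R is (\<lambda>b. 1 * c b + (-y) * d b) j"
      by (rule combination_cong) (simp add: u_def)
    then show ?thesis
      unfolding combination_append combination_linear c d
      by (simp add: u_def g_def algebra_simps)
  qed
  have pivot: "g i \<noteq> fitted R is g i"
  proof
    assume eq: "g i = fitted R is g i"
    \<comment> \<open>A vanishing pivot would make \<open>u 1 - u 0\<close> a kernel vector with last entry 1.\<close>
    have "combination R (is @ [i]) (u 1) l = combination R (is @ [i]) (u 0) l"
      if "l \<in> set (is @ [i])" for l
      unfolding u using that eq fitted_on_active[OF assms(2)] by auto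
    then have "\<forall>l\<in>set (is @ [i]). combination R (is @ [i]) (\<lambda>b. 1 * u 1 b + (-1) * u 0 b) l = 0"
      unfolding combination_linear by simp
    then have "\<forall>b<length (is @ [i]). 1 * u 1 b + (-1) * u 0 b = 0"
      using assms(3) unfolding regular_def by blast
    then show False by (auto simp: u_def dest!: spec[of _ ?k])
  qed
  let ?y = "(f i - fitted R is f i) / (g i - fitted R is g i)"
  have "fitted R (is @ [i]) f j = combination R (is @ [i]) (u ?y) j"
    by (rule fitted_eq_combination[OF assms(3)])
      (use pivot fitted_on_active[OF assms(2)] in \<open>auto simp: u\<close>)
  then show "fitted R (is @ [i]) f j = fitted R is f j
        + (f i - fitted R is f i) * ((g j - fitted R is g j) / (g i - fitted R is g i))"
    by (simp add: u)
qed

section \<open>Maxima and their arguments\<close>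

lemma arg_max_on_finite:
  fixes f :: "nat \<Rightarrow> real"
  assumes "finite S" "S \<noteq> {}"
  shows "arg_max_on f S \<in> S" and "\<And>j. j \<in> S \<Longrightarrow> f j \<le> f (arg_max_on f S)"
    and "Max (f ` S) = f (arg_max_on f S)"
proof -
  have "Max (f ` S) \<in> f ` S" using assms by (intro Max_in) auto
  then obtain m where "m \<in> S" "f m = Max (f ` S)" by (elim imageE) simp
  then have "is_arg_max f (\<lambda>x. x \<in> S) m" using assms by (simp add: is_arg_max_linorder)
  then have *: "is_arg_max f (\<lambda>x. x \<in> S) (arg_max_on f S)"
    unfolding arg_max_on_def arg_max_def by (rule someI)
  then show "arg_max_on f S \<in> S" "\<And>j. j \<in> S \<Longrightarrow> f j \<le> f (arg_max_on f S)"
    by (auto simp: is_arg_max_linorder)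
  then show "Max (f ` S) = f (arg_max_on f S)"
    using assms by (intro Max_eqI) auto
qed

lemma unique_arg_max_on_nonempty: "unique_arg_max_on f S \<Longrightarrow> S \<noteq> {}"
  unfolding unique_arg_max_on_def is_arg_max_def by blast

lemma unique_arg_max_on_less:
  assumes "unique_arg_max_on f S" "finite S" "j \<in> S" "j \<noteq> arg_max_on f S"
  shows "f j < f (arg_max_on f S)"
proof (rule ccontr)
  have S: "S \<noteq> {}" using assms(3) by auto
  note m = arg_max_on_finite[OF assms(2) S, where f = f]
  assume "\<not> f j < f (arg_max_on f S)"
  then have "is_arg_max f (\<lambda>x. x \<in> S) j"
    using m(2) assms(3) by (auto simp: is_arg_max_linorder intro: order_trans[OF _ leI])
  moreover have "is_arg_max f (\<lambda>x. x \<in> S) (arg_max_on f S)"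
    using m by (auto simp: is_arg_max_linorder)
  ultimately show False using assms(1,4) unfolding unique_arg_max_on_def by blast
qed

lemma arg_max_on_cong:
  assumes "\<And>j. j \<in> S \<Longrightarrow> f j = g j"
  shows "arg_max_on f S = arg_max_on g S"
proof -
  have "is_arg_max f (\<lambda>x. x \<in> S) = is_arg_max g (\<lambda>x. x \<in> S)"
    using assms by (auto simp: is_arg_max_def fun_eq_iff)
  then show ?thesis by (simp add: arg_max_on_def arg_max_def)
qed

section \<open>Signed variables\<close>

lemma signed_sgn_eq:
  assumes "i < 2 * p"
  shows "signed_sgn p i = (if i < p then 1 else - 1)"
    and "signed_var p i = (if i < p then i else i - p)"
    and "signed_var p i < p"
proof -
  show v: "signed_var p i = (if i < p then i else i - p)"
    using assms by (auto simp: signed_var_def mod_if)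
  show "signed_var p i < p" using v assms by auto
  show "signed_sgn p i = (if i < p then 1 else - 1)"
    using assms by (auto simp: signed_sgn_def v of_nat_diff)
qed

lemma signed_sgn_square:
  "i < 2 * p \<Longrightarrow> signed_sgn p i * signed_sgn p i = 1"
  by (simp add: signed_sgn_eq)

lemma signed_corr_index:
  assumes "i < 2 * dim_vec Z"
  shows "signed_corr Z $ i = signed_sgn (dim_vec Z) i * Z $ signed_var (dim_vec Z) i"
  using assms by (auto simp: signed_corr_def signed_sgn_eq)

lemma signed_gram_index:
  assumes "R \<in> carrier_mat p p" "i < 2 * p" "j < 2 * p"
  shows "signed_gram R $$ (i, j)
    = signed_sgn p i * signed_sgn p j * R $$ (signed_var p i, signed_var p j)"
  using assms by (auto simp: signed_gram_def signed_sgn_eq)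

lemma combination_signed:
  assumes "R \<in> carrier_mat p p" "set js \<subseteq> {..<2 * p}" "j < 2 * p"
  shows "combination (signed_gram R) js c j = signed_sgn p j
    * combination R (map (signed_var p) js) (\<lambda>b. c b * signed_sgn p (js ! b)) (signed_var p j)"
proof -
  have "js ! b < 2 * p" if "b < length js" for b using assms(2) nth_mem[OF that] by auto
  then show ?thesis unfolding combination_def sum_distrib_left
    using assms by (auto simp: signed_gram_index intro!: sum.cong)
qed

lemma regular_signed:
  assumes "R \<in> carrier_mat p p" "set js \<subseteq> {..<2 * p}" "regular R (map (signed_var p) js)"
  shows "regular (signed_gram R) js"
  unfolding regular_def
proof (intro allI impI)
  fix c b assume c: "\<forall>i\<in>set js. combination (signed_gram R) js c i = 0" and b: "b < length js"
  have "combination R (map (signed_var p) js) (\<lambda>b. c b * signed_sgn p (js ! b)) (signed_var p i) = 0"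
    if "i \<in> set js" for i
  proof -
    have i: "i < 2 * p" using that assms(2) by auto
    then have "signed_sgn p i \<noteq> 0" by (simp add: signed_sgn_eq)
    then show ?thesis
      using c that combination_signed[OF assms(1,2) i, of c] by auto
  qed
  then have "\<forall>i\<in>set (map (signed_var p) js).
      combination R (map (signed_var p) js) (\<lambda>b. c b * signed_sgn p (js ! b)) i = 0"
    by simp
  then have "\<forall>b<length (map (signed_var p) js). c b * signed_sgn p (js ! b) = 0"
    using assms(3) unfolding regular_def by blast
  then have "c b * signed_sgn p (js ! b) = 0" using b by simp
  moreover have "js ! b < 2 * p" using assms(2) nth_mem[OF b] by auto
  ultimately show "c b = 0" by (simp add: signed_sgn_eq split: if_splits)
qed

text \<open>
  The signed Gram matrix is the unsigned one with rows and columns multiplied by signs, so interpolation commutes with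
  the change of signs. This is what identifies \<open>\<theta>\<close> and \<open>\<Pi>(Z)\<close> of the projected
  formulation with their unsigned counterparts.
\<close>
lemma fitted_signed:
  assumes R: "R \<in> carrier_mat p p" and js: "set js \<subseteq> {..<2 * p}"
    and reg: "regular R (map (signed_var p) js)" and j: "j < 2 * p"
    and f: "\<And>i. i \<in> set js \<Longrightarrow> f i = signed_sgn p i * g (signed_var p i)"
  shows "fitted (signed_gram R) js f j
    = signed_sgn p j * fitted R (map (signed_var p) js) g (signed_var p j)"
proof -
  let ?is = "map (signed_var p) js"
  obtain c where c: "\<And>j. fitted R ?is g j = combination R ?is c j"
    "\<And>i. i \<in> set ?is \<Longrightarrow> combination R ?is c i = g i"
    using fitted_is_combination[OF reg] by metis
  define d where "d b = c b * signed_sgn p (js ! b)" for b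
  have d: "combination (signed_gram R) js d i = signed_sgn p i * combination R ?is c (signed_var p i)"
    if "i < 2 * p" for i
  proof -
    have "combination R ?is (\<lambda>b. d b * signed_sgn p (js ! b)) (signed_var p i)
        = combination R ?is c (signed_var p i)"
    proof (rule combination_cong)
      fix b assume "b < length ?is"
      then have "js ! b \<in> set js" by simp
      then have "js ! b < 2 * p" using js by auto
      then show "d b * signed_sgn p (js ! b) = c b" by (simp add: d_def signed_sgn_eq)
    qed
    then show ?thesis by (simp add: combination_signed[OF R js that])
  qed
  have "fitted (signed_gram R) js f j = combination (signed_gram R) js d j"
  proof (rule fitted_eq_combination[OF regular_signed[OF R js reg]])
    fix i assume i: "i \<in> set js"
    then have "i < 2 * p" using js by auto
    then show "combination (signed_gram R) js d i = f i" using i by (simp add: d c(2) f)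
  qed
  then show ?thesis by (simp add: d[OF j] c(1))
qed

section \<open>Gram matrices\<close>

text \<open>
  If \<open>R c\<close> vanishes on the support of \<open>c\<close>, then \<open>c\<^sup>T R c\<close> is 0. As this
  is the squared norm of \<open>X c\<close>, the vector \<open>X c\<close> itself is 0, and so are its products with
  \<open>Y\<close> and with every column of \<open>X\<close>.
\<close>
lemma gram_null_combination:
  fixes X :: "real mat" and Y :: "real vec"
  assumes X: "X \<in> carrier_mat n p" and Y: "Y \<in> carrier_vec n"
    and "is": "set is \<subseteq> {..<p}"
    and null: "\<And>i. i \<in> set is \<Longrightarrow> combination (X\<^sup>T * X) is c i = 0"
  shows "(\<Sum>b<length is. c b * (X\<^sup>T *\<^sub>v Y) $ (is ! b)) = 0"
    and "j < p \<Longrightarrow> combination (X\<^sup>T * X) is c j = 0"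
proof -
  let ?k = "length is"
  have lt: "is ! b < p" if "b < ?k" for b using "is" nth_mem[OF that] by auto
  define v where "v m = (\<Sum>b<?k. c b * X $$ (m, is ! b))" for m
  have comb: "combination (X\<^sup>T * X) is c j = (\<Sum>m<n. X $$ (m, j) * v m)" if "j < p" for j
  proof -
    have "combination (X\<^sup>T * X) is c j = (\<Sum>b<?k. \<Sum>m<n. X $$ (m, j) * (c b * X $$ (m, is ! b)))"
      unfolding combination_def using X that lt
      by (auto simp: scalar_prod_def atLeast0LessThan sum_distrib_left mult_ac intro!: sum.cong)
    then show ?thesis unfolding v_def sum_distrib_left by (subst sum.swap) simp
  qed
  have "(\<Sum>m<n. v m * v m) = (\<Sum>m<n. \<Sum>b<?k. c b * (X $$ (m, is ! b) * v m))"
    by (rule sum.cong) (simp_all add: v_def sum_distrib_right mult_ac)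
  also have "\<dots> = (\<Sum>b<?k. c b * combination (X\<^sup>T * X) is c (is ! b))"
    by (subst sum.swap) (simp add: comb lt sum_distrib_left)
  also have "\<dots> = 0" using null by (auto intro!: sum.neutral)
  finally have v: "v m = 0" if "m < n" for m
    using that by (subst (asm) sum_nonneg_eq_0_iff) auto
  show "combination (X\<^sup>T * X) is c j = 0" if "j < p" using v by (simp add: comb[OF that])
  have "(\<Sum>b<?k. c b * (X\<^sup>T *\<^sub>v Y) $ (is ! b)) = (\<Sum>b<?k. \<Sum>m<n. Y $ m * (c b * X $$ (m, is ! b)))"
    using X Y lt
    by (auto simp: scalar_prod_def atLeast0LessThan sum_distrib_left mult_ac intro!: sum.cong)
  also have "\<dots> = (\<Sum>m<n. Y $ m * v m)"
    unfolding v_def sum_distrib_left by (subst sum.swap) simp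
  finally show "(\<Sum>b<?k. c b * (X\<^sup>T *\<^sub>v Y) $ (is ! b)) = 0" using v by simp
qed

text \<open>
  The properties of a Gram matrix and its correlation vector that the equivalence rests on. Being positive
  semidefinite enters only through the null vectors: a null vector of a principal submatrix annihilates
  \<open>R\<close> and is orthogonal to \<open>Z\<close>.
\<close>
locale gram_data =
  fixes p :: nat and R :: "real mat" and Z :: "real vec"
  assumes gram_carrier: "R \<in> carrier_mat p p"
    and corr_dim: "dim_vec Z = p"
    and gram_sym: "i < p \<Longrightarrow> j < p \<Longrightarrow> R $$ (i, j) = R $$ (j, i)"
    and null_corr: "set is \<subseteq> {..<p} \<Longrightarrow> (\<And>i. i \<in> set is \<Longrightarrow> combination R is c i = 0)
      \<Longrightarrow> (\<Sum>b<length is. c b * Z $ (is ! b)) = 0"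
    and null_gram: "set is \<subseteq> {..<p} \<Longrightarrow> (\<And>i. i \<in> set is \<Longrightarrow> combination R is c i = 0)
      \<Longrightarrow> j < p \<Longrightarrow> combination R is c j = 0"

lemma gram_data_mult:
  fixes X :: "real mat" and Y :: "real vec"
  assumes "X \<in> carrier_mat n p" "Y \<in> carrier_vec n"
  shows "gram_data p (X\<^sup>T * X) (X\<^sup>T *\<^sub>v Y)"
proof (unfold_locales, goal_cases)
  case 1
  show ?case using assms by simp
next
  case 2
  show ?case using assms by simp
next
  case (3 i j)
  then show ?case
    using assms by (auto simp: scalar_prod_def mult.commute intro!: sum.cong)
next
  case (4 "is" c)
  then show ?case by (rule gram_null_combination(1)[OF assms])
next
  case (5 "is" c j)
  then show ?case by (rule gram_null_combination(2)[OF assms])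
qed

context gram_data
begin

text \<open>
  A null vector of the enlarged submatrix expresses column \<open>i\<close>, and with the same coefficients the
  correlation \<open>Z\<^sub>i\<close>, by the active ones. Symmetry of \<open>R\<close> lets these coefficients be
  exchanged with those of the interpolant of \<open>Z\<close>.
\<close>
lemma fitted_corr_if_dependent:
  assumes "set is \<subseteq> {..<p}" "i < p" "regular R is" "\<not> regular R (is @ [i])"
  shows "fitted R is (\<lambda>j. Z $ j) i = Z $ i"
proof -
  let ?k = "length is"
  obtain c where c0: "\<And>j. j \<in> set (is @ [i]) \<Longrightarrow> combination R (is @ [i]) c j = 0"
    and cnz: "\<not> (\<forall>b<length (is @ [i]). c b = 0)"
    using assms(4) unfolding regular_def by blast
  have sub: "set (is @ [i]) \<subseteq> {..<p}" using assms by auto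
  have ck: "c ?k \<noteq> 0"
  proof
    assume ck: "c ?k = 0"
    then have "\<forall>j\<in>set is. combination R is c j = 0" using c0 by (simp add: combination_append)
    then have "\<forall>b<?k. c b = 0" using assms(3) unfolding regular_def by blast
    then show False using cnz ck by (auto simp: less_Suc_eq)
  qed
  have Zi: "c ?k * Z $ i = - (\<Sum>b<?k. c b * Z $ (is ! b))"
    using null_corr[OF sub c0] by (simp add: nth_append)
  have Ri: "c ?k * R $$ (j, i) = - combination R is c j" if "j < p" for j
    using null_gram[OF sub c0 that] by (simp add: combination_append)
  obtain d where d: "\<And>j. fitted R is (\<lambda>j. Z $ j) j = combination R is d j"
    "\<And>i. i \<in> set is \<Longrightarrow> combination R is d i = Z $ i"
    using fitted_is_combination[OF assms(3)] by metis
  have lt: "is ! b < p" if "b < ?k" for b using assms(1) nth_mem[OF that] by auto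
  have "c ?k * combination R is d i = (\<Sum>a<?k. d a * (c ?k * R $$ (is ! a, i)))"
    unfolding combination_def sum_distrib_left
    using gram_sym assms(2) lt by (auto intro!: sum.cong)
  also have "\<dots> = - (\<Sum>a<?k. \<Sum>b<?k. c b * (d a * R $$ (is ! b, is ! a)))"
    unfolding sum_negf[symmetric]
    using gram_sym lt
    by (auto simp: Ri combination_def sum_distrib_left sum_negf mult_ac intro!: sum.cong)
  also have "\<dots> = - (\<Sum>b<?k. c b * combination R is d (is ! b))"
    unfolding combination_def sum_distrib_left by (subst sum.swap) simp
  also have "\<dots> = - (\<Sum>b<?k. c b * Z $ (is ! b))" by (simp add: d(2))
  also have "\<dots> = c ?k * Z $ i" by (simp add: Zi)
  finally show ?thesis using ck by (simp add: d(1))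
qed


end

section \<open>The standard and the projected formulation\<close>

lemma proj_theta_fitted: "proj_theta R is j = fitted R is (\<lambda>_. 1) j"
  by (simp add: proj_theta_def fitted_def)

lemma proj_corr_fitted: "proj_corr R Z is j = fitted R is (\<lambda>i. Z $ i) j"
  by (simp add: proj_corr_def fitted_def)

lemma dim_signed_corr [simp]: "dim_vec (signed_corr Z) = 2 * dim_vec Z"
  by (simp add: signed_corr_def)

text \<open>
  With slope at least 1, the gap between the line and the diagonal does not shrink when the argument decreases from
  \<open>lam\<close>. Only a line with smaller slope can meet the diagonal there.
\<close>
lemma line_meets_diagonal:
  fixes A T \<beta> lam :: real
  assumes "A < lam * (1 - T)" "\<beta> \<le> lam"
  shows "A + \<beta> * T = \<beta> \<longleftrightarrow> T < 1 \<and> A / (1 - T) = \<beta>"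
proof
  assume eq: "A + \<beta> * T = \<beta>"
  have "T < 1"
  proof (rule ccontr)
    assume "\<not> T < 1"
    then have "(lam - \<beta>) * (1 - T) \<le> 0" using assms(2) by (intro mult_nonneg_nonpos) auto
    then show False using eq assms(1) by (simp add: algebra_simps)
  qed
  then show "T < 1 \<and> A / (1 - T) = \<beta>" using eq by (simp add: divide_eq_eq algebra_simps)
next
  assume "T < 1 \<and> A / (1 - T) = \<beta>"
  then show "A + \<beta> * T = \<beta>" by (auto simp: divide_eq_eq algebra_simps)
qed

lemma line_below_diagonal:
  fixes A T \<beta> lam :: real
  assumes "A < lam * (1 - T)" "\<beta> \<le> lam" "T < 1 \<Longrightarrow> A / (1 - T) \<le> \<beta>"
  shows "A + \<beta> * T \<le> \<beta>"
proof (cases "T < 1")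
  case True
  then have "A \<le> \<beta> * (1 - T)" using assms(3) by (simp add: pos_divide_le_eq)
  then show ?thesis by (simp add: algebra_simps)
next
  case False
  then have "(lam - \<beta>) * (1 - T) \<le> 0" using assms(2) by (intro mult_nonneg_nonpos) auto
  then show ?thesis using assms(1) by (simp add: algebra_simps)
qed

text \<open>
  The state that the standard and the projected formulation share at a knot, in terms of the signed active variables.
  The assumptions \<open>active\<close> and \<open>bounded\<close> together record that the last maximum was attained
  only once: an inactive variable is strictly inside. The assumption \<open>span\<close> expresses that
  \<open>N\<close> comes from \<open>Z\<close> by moving along active columns only.
\<close>
locale lars_state = gram_data p R Z for p R Z +
  fixes lam :: real and js :: "nat list" and N :: "real vec"
  assumes lam_pos: "0 < lam"
    and N_dim: "dim_vec N = p"
    and js_lt: "set js \<subseteq> {..<2 * p}"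
    and active: "set (map (signed_var p) js) = {j. j < p \<and> \<bar>N $ j\<bar> = lam}"
    and sign: "i \<in> set js \<Longrightarrow> signed_sgn p i * N $ signed_var p i = lam"
    and bounded: "j < p \<Longrightarrow> \<bar>N $ j\<bar> \<le> lam"
    and regular_active: "regular R (map (signed_var p) js)"
    and span: "j < p \<Longrightarrow> Z $ j - N $ j = fitted R (map (signed_var p) js) (\<lambda>i. Z $ i - N $ i) j"
begin

abbreviation "act \<equiv> map (signed_var p) js"

abbreviation "state \<equiv> Std lam act (map (signed_sgn p) js) N"

definition theta :: "nat \<Rightarrow> real" where
  "theta j = fitted R act (\<lambda>j. N $ j / lam) j"

text \<open>The correlation with the part of \<open>Y\<close> that is orthogonal to the active columns.\<close>
definition resid :: "nat \<Rightarrow> real" where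
  "resid j = Z $ j - fitted R act (\<lambda>i. Z $ i) j"

text \<open>
  Slope and offset of the line followed by a signed variable; these are \<open>\<theta>\<close> and \<open>Z -
  \<Pi>(Z)\<close> of the projected formulation (\<open>proj_theta_eq\<close>, \<open>proj_corr_eq\<close>).
\<close>
definition slope :: "nat \<Rightarrow> real" where
  "slope i = signed_sgn p i * theta (signed_var p i)"

definition offset :: "nat \<Rightarrow> real" where
  "offset i = signed_sgn p i * resid (signed_var p i)"

definition path :: "real \<Rightarrow> nat \<Rightarrow> real" where
  "path \<beta> j = resid j + \<beta> * theta j"

definition cands :: "nat set" where
  "cands = {i. i < 2 * p \<and> slope i < 1}"

definition ratio :: "nat \<Rightarrow> real" where
  "ratio i = offset i / (1 - slope i)"

lemma theta_active: "j \<in> set act \<Longrightarrow> theta j = N $ j / lam"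
  unfolding theta_def by (rule fitted_on_active[OF regular_active])

lemma resid_active: "j \<in> set act \<Longrightarrow> resid j = 0"
  unfolding resid_def using fitted_on_active[OF regular_active, of j "\<lambda>i. Z $ i"] by simp

lemma path_active: "j \<in> set act \<Longrightarrow> path \<beta> j = \<beta> * (N $ j / lam)"
  by (simp only: path_def resid_active theta_active add_0)

text \<open>
  The standard formulation updates \<open>N\<close> incrementally, starting from the last knot. Applying the
  interpolation to \<open>Z - N\<close>, which it fixes, and to \<open>N\<close>, which equals \<open>lam\<close>
  times the signs on the active set, expresses \<open>N\<close> by \<open>Z\<close> and \<open>\<theta>\<close> alone.
\<close>
lemma path_lam:
  assumes "j < p"
  shows "path lam j = N $ j"
proof -
  have "fitted R act (\<lambda>i. N $ i) j = lam * theta j"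
    using fitted_linear[OF regular_active, where x = lam and y = 0 and f = "\<lambda>j. N $ j / lam"
        and g = "\<lambda>_. 0"] lam_pos by (simp add: theta_def)
  then show ?thesis
    using span[OF assms] fitted_linear[OF regular_active, where x = 1 and y = "-1"
        and f = "\<lambda>i. Z $ i" and g = "\<lambda>i. N $ i" and j = j] by (simp add: path_def resid_def)
qed

lemma signed_path: "signed_sgn p i * path \<beta> (signed_var p i) = offset i + \<beta> * slope i"
  by (simp add: path_def offset_def slope_def algebra_simps)

lemma std_theta_eq: "std_theta R state j = theta j"
proof -
  have "vec_of_list (map (signed_sgn p) js) = vec (length act) (\<lambda>a. N $ (act ! a) / lam)"
  proof (rule eq_vecI)
    fix a assume "a < dim_vec (vec (length act) (\<lambda>a. N $ (act ! a) / lam))"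
    then have a: "a < length js" by simp
    then have i: "js ! a \<in> set js" by simp
    then have "js ! a < 2 * p" using js_lt by auto
    then have "signed_sgn p (js ! a) = N $ (signed_var p (js ! a)) / lam"
      using sign[OF i] lam_pos by (auto simp: signed_sgn_eq(1) field_simps split: if_splits)
    then show "vec_of_list (map (signed_sgn p) js) $ a
        = vec (length act) (\<lambda>a. N $ (act ! a) / lam) $ a"
      using a by (simp add: vec_of_list_index)
  qed simp
  then show ?thesis by (simp add: std_theta_def theta_def fitted_def)
qed

lemma std_path_eq: "std_path R state \<beta> = vec p (path \<beta>)"
proof (rule eq_vecI)
  fix j assume "j < dim_vec (vec p (path \<beta>))"
  then have j: "j < p" by simp
  have "std_path R state \<beta> $ j = path lam j - (lam - \<beta>) * theta j"
    using j by (simp add: std_path_def N_dim std_theta_eq path_lam)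
  then show "std_path R state \<beta> $ j = vec p (path \<beta>) $ j"
    using j by (simp add: path_def algebra_simps)
qed (simp add: std_path_def N_dim)

lemma inactive_iff: "j \<in> std_inactive state \<longleftrightarrow> j < p \<and> j \<notin> set act"
  by (simp add: std_inactive_def N_dim)

lemma std_hits_iff:
  "\<beta> \<in> std_hits R state \<longleftrightarrow>
    0 < \<beta> \<and> \<beta> \<le> lam \<and> (\<exists>j. j < p \<and> j \<notin> set act \<and> \<bar>path \<beta> j\<bar> = \<beta>)"
  unfolding std_hits_def mem_Collect_eq Bex_def inactive_iff std_path_eq
  by (auto simp del: set_map)

lemma proj_theta_eq:
  assumes "i < 2 * p"
  shows "proj_theta (signed_gram R) js i = slope i"
  unfolding proj_theta_fitted slope_def theta_def
proof (rule fitted_signed[OF gram_carrier js_lt regular_active assms])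
  fix l assume "l \<in> set js"
  then show "1 = signed_sgn p l * (N $ signed_var p l / lam)" using sign[of l] lam_pos by simp
qed

lemma proj_corr_eq:
  assumes i: "i < 2 * p"
  shows "signed_corr Z $ i - proj_corr (signed_gram R) (signed_corr Z) js i = offset i"
proof -
  have corr: "signed_corr Z $ l = signed_sgn p l * Z $ signed_var p l" if "l < 2 * p" for l
    using signed_corr_index[of l Z] that by (simp add: corr_dim)
  have "proj_corr (signed_gram R) (signed_corr Z) js i
      = signed_sgn p i * fitted R act (\<lambda>i. Z $ i) (signed_var p i)"
    unfolding proj_corr_fitted
    by (rule fitted_signed[OF gram_carrier js_lt regular_active i]) (use js_lt corr in auto)
  then show ?thesis by (simp add: corr[OF i] offset_def resid_def right_diff_distrib)
qed

lemma proj_cands_eq: "proj_cands (signed_gram R) (signed_corr Z) js = cands"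
  by (auto simp: proj_cands_def cands_def corr_dim proj_theta_eq)

lemma proj_ratio_eq: "i \<in> cands \<Longrightarrow> proj_ratio (signed_gram R) (signed_corr Z) js i = ratio i"
  by (simp add: proj_ratio_def ratio_def cands_def proj_theta_eq proj_corr_eq)

lemma offset_inactive:
  assumes i: "i < 2 * p" "signed_var p i \<notin> set act"
  shows "offset i < lam * (1 - slope i)"
proof -
  have v: "signed_var p i < p" by (rule signed_sgn_eq(3)[OF i(1)])
  then have "\<bar>N $ signed_var p i\<bar> < lam"
    using i(2) bounded[OF v] unfolding active by simp
  then have "signed_sgn p i * path lam (signed_var p i) < lam"
    unfolding path_lam[OF v] using i(1) by (auto simp: signed_sgn_eq(1))
  then show ?thesis unfolding signed_path by (simp add: algebra_simps)
qed

lemma ratio_pos_inactive: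
  assumes "0 < ratio i"
  shows "signed_var p i \<notin> set act"
  using assms resid_active[of "signed_var p i"] by (auto simp: ratio_def offset_def simp del: set_map)

lemma signed_representative:
  assumes "j < p"
  obtains i where "i < 2 * p" "signed_var p i = j" "signed_sgn p i * x = \<bar>x\<bar>"
  using assms
  by (intro that[of "if 0 \<le> x then j else j + p"]) (auto simp: signed_sgn_eq(1,2))

text \<open>
  A hit of level \<open>\<beta>\<close> by an inactive variable is a signed line meeting the diagonal at
  \<open>\<beta>\<close>. Active variables drop out on both sides: their offset is 0, so they have no positive ratio.
\<close>
lemma std_hits_eq: "std_hits R state = {\<beta>. 0 < \<beta> \<and> (\<exists>i\<in>cands. ratio i = \<beta>)}"
proof (intro equalityI subsetI)
  fix \<beta> assume "\<beta> \<in> std_hits R state"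
  then obtain j where \<beta>: "0 < \<beta>" "\<beta> \<le> lam" and j: "j < p" "j \<notin> set act" "\<bar>path \<beta> j\<bar> = \<beta>"
    unfolding std_hits_iff by blast
  obtain i where i: "i < 2 * p" "signed_var p i = j" "signed_sgn p i * path \<beta> j = \<beta>"
    using signed_representative[OF j(1), of "path \<beta> j"] j(3) by metis
  then have "offset i + \<beta> * slope i = \<beta>" using signed_path[of i \<beta>] by simp
  then have "slope i < 1 \<and> ratio i = \<beta>"
    using line_meets_diagonal[OF offset_inactive \<beta>(2), of i] i j(2) by (simp add: ratio_def)
  then show "\<beta> \<in> {\<beta>. 0 < \<beta> \<and> (\<exists>i\<in>cands. ratio i = \<beta>)}"
    using \<beta>(1) i(1) by (auto simp: cands_def)
next
  fix \<beta> assume "\<beta> \<in> {\<beta>. 0 < \<beta> \<and> (\<exists>i\<in>cands. ratio i = \<beta>)}"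
  then obtain i where \<beta>: "0 < \<beta>" "ratio i = \<beta>" and i: "i < 2 * p" "slope i < 1"
    by (auto simp: cands_def)
  have inact: "signed_var p i \<notin> set act" using ratio_pos_inactive \<beta> by simp
  have "ratio i < lam"
    using offset_inactive[OF i(1) inact] i(2) by (simp add: ratio_def pos_divide_less_eq)
  then have le: "\<beta> \<le> lam" using \<beta>(2) by simp
  have "offset i + \<beta> * slope i = \<beta>"
    using line_meets_diagonal[OF offset_inactive[OF i(1) inact] le] i(2) \<beta>(2)
    by (simp add: ratio_def)
  then have "signed_sgn p i * path \<beta> (signed_var p i) = \<beta>" unfolding signed_path .
  then have "\<bar>path \<beta> (signed_var p i)\<bar> = \<beta>"
    using \<beta>(1) i(1) by (auto simp: signed_sgn_eq(1) split: if_splits)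
  then show "\<beta> \<in> std_hits R state"
    unfolding std_hits_iff using \<beta>(1) le inact signed_sgn_eq(3)[OF i(1)] by blast
qed

text \<open>
  If \<open>m\<close> depended on the active variables, its line would have offset 0 and, being on the boundary at
  \<open>\<beta>\<close>, \<open>\<theta> = \<plusminus>1\<close>. It would already have been on the boundary at the
  last knot.
\<close>
lemma regular_append:
  assumes m: "m < p" "m \<notin> set act" and hit: "\<bar>path \<beta> m\<bar> = \<beta>" "0 < \<beta>"
  shows "regular R (act @ [m])"
proof (rule ccontr)
  assume "\<not> regular R (act @ [m])"
  moreover have "set act \<subseteq> {..<p}" unfolding active by auto
  ultimately have "resid m = 0"
    using fitted_corr_if_dependent[OF _ m(1) regular_active] by (simp add: resid_def)
  then have *: "path \<gamma> m = \<gamma> * theta m" for \<gamma> by (simp add: path_def)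
  then have "\<bar>theta m\<bar> = 1" using hit by (simp add: abs_mult)
  moreover have "N $ m = lam * theta m" using path_lam[OF m(1)] *[of lam] by simp
  then have "\<bar>N $ m\<bar> = \<bar>lam\<bar> * \<bar>theta m\<bar>" by (simp only: abs_mult)
  ultimately have "\<bar>N $ m\<bar> = lam" using lam_pos by simp
  then show False using m unfolding active by simp
qed

text \<open>
  With only the old nodes, \<open>Z - path \<beta>\<close> is its own interpolant; being exact at \<open>m\<close> as
  well, it is not changed by the new node.
\<close>
lemma path_span_append:
  assumes reg: "regular R (act @ [m])"
  shows "Z $ j - path \<beta> j = fitted R (act @ [m]) (\<lambda>i. Z $ i - path \<beta> i) j"
proof -
  have old: "fitted R act (\<lambda>i. Z $ i - path \<beta> i) j = Z $ j - path \<beta> j" for j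
  proof -
    have "fitted R act (\<lambda>i. Z $ i - path \<beta> i) j
        = fitted R act (\<lambda>i. 1 * Z $ i + (- \<beta>) * (N $ i / lam)) j"
      by (rule fitted_cong) (simp add: path_active del: set_map)
    also have "\<dots> = Z $ j - path \<beta> j"
      unfolding fitted_linear[OF regular_active] path_def resid_def theta_def by simp
    finally show ?thesis .
  qed
  show ?thesis
    using fitted_append[OF regular_active reg, of "\<lambda>i. Z $ i - path \<beta> i" j]
    by (simp add: old)
qed

text \<open>
  By \<open>std_hits_eq\<close> the next knot of the standard formulation is the maximal ratio of the projected one.
  At this level no inactive line has risen above the diagonal, so the maximum of the correlations in absolute value is
  the knot itself, and its unique maximizer is the variable of any maximizer of the ratio.
\<close>
lemma next_state:
  assumes hits: "\<exists>\<beta>\<in>std_hits R state. \<forall>\<gamma>\<in>std_hits R state. \<gamma> \<le> \<beta>"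
    and unique: "unique_arg_max_on (\<lambda>j. \<bar>std_path R state (std_next_knot R state) $ j\<bar>)
      (std_inactive state)"
  obtains mu h where "mu \<le> lam" "lars_state p R Z mu (js @ [h]) (vec p (path mu))"
    "std_step R state
      = Std mu (map (signed_var p) (js @ [h])) (map (signed_sgn p) (js @ [h])) (vec p (path mu))"
    "proj_step (signed_gram R) (signed_corr Z) (lam, js) = (mu, js @ [h])"
proof -
  define mu where "mu = std_next_knot R state"
  obtain \<beta> where \<beta>: "\<beta> \<in> std_hits R state" "\<And>\<gamma>. \<gamma> \<in> std_hits R state \<Longrightarrow> \<gamma> \<le> \<beta>"
    using hits by blast
  then have "mu = \<beta>" unfolding mu_def std_next_knot_def by (intro Greatest_equality) auto
  with \<beta> have mu: "mu \<in> std_hits R state" "\<And>\<gamma>. \<gamma> \<in> std_hits R state \<Longrightarrow> \<gamma> \<le> mu"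
    by auto
  have mu_pos: "0 < mu" and mu_le: "mu \<le> lam" using mu(1) by (auto simp: std_hits_def)
  have ratio_le: "ratio i \<le> mu" if "i \<in> cands" for i
    using mu(2)[of "ratio i"] that mu_pos unfolding std_hits_eq by (cases "0 < ratio i") auto
  obtain i0 where i0: "i0 \<in> cands" "ratio i0 = mu" using mu(1) unfolding std_hits_eq by auto

  \<comment> \<open>The maximal ratio is attained at \<open>h\<close>, whose variable \<open>m\<close> is then on the boundary at \<open>mu\<close>.\<close>
  define h where "h = arg_max_on ratio cands"
  have "finite cands" "cands \<noteq> {}" using i0(1) by (auto simp: cands_def)
  note hmax = arg_max_on_finite[OF this, where f = ratio, folded h_def]
  have ratio_h: "ratio h = mu" using hmax(2)[OF i0(1)] ratio_le[OF hmax(1)] i0(2) by simp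
  have h: "h < 2 * p" "slope h < 1" using hmax(1) by (auto simp: cands_def)
  define m where "m = signed_var p h"
  have m: "m < p" unfolding m_def by (rule signed_sgn_eq(3)[OF h(1)])
  have m_inact: "m \<notin> set act" using ratio_pos_inactive ratio_h mu_pos by (simp add: m_def)
  have sgn_h: "signed_sgn p h * path mu m = mu"
  proof -
    have "offset h + mu * slope h = mu"
      using line_meets_diagonal[OF offset_inactive[OF h(1)] mu_le] m_inact h(2) ratio_h
      by (simp add: ratio_def m_def)
    then show ?thesis unfolding m_def signed_path .
  qed
  have abs_m: "\<bar>path mu m\<bar> = mu"
    using sgn_h mu_pos h(1) by (auto simp: signed_sgn_eq(1) split: if_splits)
  have sgn_h_eq: "signed_sgn p h = path mu m / mu"
    using sgn_h mu_pos h(1) by (auto simp: signed_sgn_eq(1) field_simps split: if_splits)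

  have below: "\<bar>path mu j\<bar> \<le> mu" if j: "j < p" "j \<notin> set act" for j
  proof -
    obtain i where i: "i < 2 * p" "signed_var p i = j" "signed_sgn p i * path mu j = \<bar>path mu j\<bar>"
      using signed_representative[OF j(1)] by metis
    have "offset i + mu * slope i \<le> mu"
      by (rule line_below_diagonal[OF offset_inactive mu_le])
        (use i j ratio_le[of i] in \<open>auto simp: ratio_def cands_def\<close>)
    then show ?thesis using signed_path[of i mu] i by simp
  qed
  have active_abs: "\<bar>path mu j\<bar> = mu" if "j \<in> set act" for j
  proof -
    have "\<bar>N $ j\<bar> = lam" using that unfolding active by simp
    then show ?thesis unfolding path_active[OF that] using lam_pos mu_pos by (simp add: abs_mult)
  qed
  have fin: "finite (std_inactive state)" by (simp add: std_inactive_def)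
  have val: "\<bar>std_path R state mu $ j\<bar> = \<bar>path mu j\<bar>" if "j < p" for j
    using that by (simp add: std_path_eq)
  \<comment> \<open>The index chosen by the standard formulation is \<open>m\<close>: the value there is \<open>mu\<close>, and no
    inactive variable exceeds it.\<close>
  define b where "b = arg_max_on (\<lambda>j. \<bar>std_path R state mu $ j\<bar>) (std_inactive state)"
  note less = unique_arg_max_on_less[OF unique[folded mu_def] fin, folded b_def]
  have "b \<in> std_inactive state"
    unfolding b_def using m m_inact by (intro arg_max_on_finite(1)[OF fin]) (auto simp: inactive_iff)
  then have b: "b < p" "b \<notin> set act" unfolding inactive_iff by auto
  have bm: "b = m"
  proof (rule ccontr)
    assume "b \<noteq> m"
    then have "\<bar>path mu m\<bar> < \<bar>path mu b\<bar>"
      using less[of m] m m_inact val[OF m] val[OF b(1)] unfolding inactive_iff by auto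
    then show False using below[OF b] abs_m by simp
  qed
  have strict: "\<bar>path mu j\<bar> < mu" if "j < p" "j \<notin> set act" "j \<noteq> m" for j
    using less[of j] that val[OF that(1)] val[OF m] abs_m bm unfolding inactive_iff by auto

  have "lars_state p R Z mu (js @ [h]) (vec p (path mu))"
  proof (unfold_locales, goal_cases)
    case 4
    have "set (act @ [m]) = {j. j < p \<and> \<bar>vec p (path mu) $ j\<bar> = mu}"
    proof (intro equalityI subsetI)
      fix j assume "j \<in> set (act @ [m])"
      then consider "j \<in> set act" | "j = m" by auto
      then have "j < p \<and> \<bar>path mu j\<bar> = mu"
      proof cases
        case 1
        then have "j < p" unfolding active by simp
        then show ?thesis using active_abs[OF 1] by simp
      qed (use m abs_m in auto)
      then show "j \<in> {j. j < p \<and> \<bar>vec p (path mu) $ j\<bar> = mu}" by simp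
    next
      fix j assume "j \<in> {j. j < p \<and> \<bar>vec p (path mu) $ j\<bar> = mu}"
      then have "j \<in> set act \<or> j = m" using strict[of j] by fastforce
      then show "j \<in> set (act @ [m])" by auto
    qed
    then show ?case by (simp add: m_def)
  next
    case (5 i)
    show ?case
    proof (cases "i \<in> set js")
      case True
      then have v: "signed_var p i \<in> set act" by simp
      then have "signed_var p i < p" unfolding active by simp
      moreover have "signed_sgn p i * path mu (signed_var p i) = mu"
        unfolding path_active[OF v] using sign[OF True] lam_pos by (simp add: field_simps)
      ultimately show ?thesis by simp
    next
      case False
      then have "i = h" using 5 by simp
      then show ?thesis using sgn_h m by (simp add: m_def)
    qed
  next
    case (6 j)
    then show ?case using below[of j] active_abs[of j] by (cases "j \<in> set act") auto
  next
    case 7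
    have "regular R (act @ [m])" by (rule regular_append[OF m m_inact abs_m mu_pos])
    then show ?case by (simp add: m_def)
  next
    case (8 j)
    have reg: "regular R (act @ [m])" by (rule regular_append[OF m m_inact abs_m mu_pos])
    have "fitted R (act @ [m]) (\<lambda>i. Z $ i - vec p (path mu) $ i) j
        = fitted R (act @ [m]) (\<lambda>i. Z $ i - path mu i) j"
    proof (rule fitted_cong)
      fix i assume "i \<in> set (act @ [m])"
      moreover have "set (act @ [m]) \<subseteq> {..<p}" using m active by auto
      ultimately show "Z $ i - vec p (path mu) $ i = Z $ i - path mu i" by auto
    qed
    then show ?case using path_span_append[OF reg, of j mu] 8 by (simp add: m_def)
  qed (use mu_pos js_lt h(1) in auto)
  moreover have "std_step R state
      = Std mu (map (signed_var p) (js @ [h])) (map (signed_sgn p) (js @ [h])) (vec p (path mu))"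
    unfolding std_step_def Let_def mu_def[symmetric] b_def[symmetric] bm
    using m by (simp add: std_path_eq sgn_h_eq m_def)
  moreover have "proj_step (signed_gram R) (signed_corr Z) (lam, js) = (mu, js @ [h])"
  proof -
    have "proj_ratio (signed_gram R) (signed_corr Z) js ` cands = ratio ` cands"
      by (rule image_cong) (simp_all add: proj_ratio_eq)
    moreover have "arg_max_on (proj_ratio (signed_gram R) (signed_corr Z) js) cands = h"
      unfolding h_def by (rule arg_max_on_cong) (rule proj_ratio_eq)
    ultimately show ?thesis by (simp add: proj_step_def proj_cands_eq hmax(3) ratio_h)
  qed
  ultimately show ?thesis using that mu_le by blast
qed

end

text \<open>
  At the first knot the maximum over the signed correlations is the maximum of the absolute values. The entering
  column is not null, since a null column has correlation 0 whereas the first knot is positive.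
\<close>
lemma (in gram_data) first_state:
  assumes unique: "unique_arg_max_on (\<lambda>j. \<bar>Z $ j\<bar>) {..<dim_vec Z}"
    and pos: "0 < std_knot (std_first Z)"
  obtains lam h where "lars_state p R Z lam [h] Z"
    "std_first Z = Std lam [signed_var p h] [signed_sgn p h] Z"
    "proj_first (signed_corr Z) = (lam, [h])"
proof -
  define i where "i = arg_max_on (\<lambda>j. \<bar>Z $ j\<bar>) {..<dim_vec Z}"
  have ne: "{..<dim_vec Z} \<noteq> {}" by (rule unique_arg_max_on_nonempty[OF unique])
  note max = arg_max_on_finite[OF finite_lessThan ne, where f = "\<lambda>j. \<bar>Z $ j\<bar>", folded i_def]
  have less: "\<bar>Z $ j\<bar> < \<bar>Z $ i\<bar>" if "j < p" "j \<noteq> i" for j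
    using unique_arg_max_on_less[OF unique, of j] that by (simp add: i_def corr_dim)
  have i: "i < p" using max(1) corr_dim by simp
  have first: "std_first Z = Std \<bar>Z $ i\<bar> [i] [Z $ i / \<bar>Z $ i\<bar>] Z"
    by (simp add: std_first_def Let_def max(3) flip: i_def)
  have Zi: "0 < \<bar>Z $ i\<bar>" using pos by (simp add: first)
  have reg: "regular R [i]"
  proof (rule ccontr)
    assume "\<not> regular R [i]"
    then have "fitted R [] (\<lambda>j. Z $ j) i = Z $ i"
      by (intro fitted_corr_if_dependent) (use i in auto)
    then show False using Zi by simp
  qed
  define h where "h = arg_max_on (\<lambda>j. signed_corr Z $ j) {..<2 * p}"
  have "{..<2 * p} \<noteq> {}" using i by (simp add: lessThan_empty_iff)
  note smax = arg_max_on_finite[OF finite_lessThan this, where f = "\<lambda>j. signed_corr Z $ j",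
      folded h_def]
  have h: "h < 2 * p" using smax(1) by simp
  have Zh: "signed_corr Z $ h = signed_sgn p h * Z $ signed_var p h"
    using signed_corr_index[of h Z] h by (simp add: corr_dim)
  define m where "m = (if 0 < Z $ i then i else i + p)"
  have m: "m < 2 * p" "signed_corr Z $ m = \<bar>Z $ i\<bar>"
    using i by (auto simp: m_def corr_dim signed_corr_index signed_sgn_eq(1,2))
  have ge: "\<bar>Z $ i\<bar> \<le> signed_corr Z $ h" using smax(2)[of m] m by simp
  moreover have le: "signed_corr Z $ h \<le> \<bar>Z $ signed_var p h\<bar>"
    unfolding Zh using h by (auto simp: signed_sgn_eq(1))
  ultimately have var: "signed_var p h = i"
    using less[OF signed_sgn_eq(3)[OF h]] by (cases "signed_var p h = i") auto
  have eq: "signed_corr Z $ h = \<bar>Z $ i\<bar>" using ge le var by simp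
  have sgn: "signed_sgn p h * Z $ i = \<bar>Z $ i\<bar>" using Zh eq var by simp
  have "signed_sgn p h * \<bar>Z $ i\<bar> = (signed_sgn p h * signed_sgn p h) * Z $ i"
    unfolding sgn[symmetric] by simp
  then have "signed_sgn p h * \<bar>Z $ i\<bar> = Z $ i" unfolding signed_sgn_square[OF h] by simp
  then have sgn_eq: "signed_sgn p h = Z $ i / \<bar>Z $ i\<bar>"
    using Zi by (simp add: eq_divide_eq)
  have "lars_state p R Z \<bar>Z $ i\<bar> [h] Z"
  proof (unfold_locales, goal_cases)
    case 4
    then show ?case using less i by (force simp: var)
  next
    case (6 j)
    then show ?case using less[of j] by (cases "j = i") auto
  next
    case (8 j)
    then show ?case
      using fitted_linear[OF reg, where x = 0 and y = 0 and j = j] by (simp add: var)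
  qed (use Zi h sgn reg in \<open>auto simp: corr_dim var\<close>)
  moreover have "std_first Z = Std \<bar>Z $ i\<bar> [signed_var p h] [signed_sgn p h] Z"
    by (simp add: first var sgn_eq)
  moreover have "proj_first (signed_corr Z) = (\<bar>Z $ i\<bar>, [h])"
    by (simp add: proj_first_def corr_dim smax(3) eq flip: h_def)
  ultimately show ?thesis using that by blast
qed

section \<open>The recursive formulation\<close>

text \<open>
  The state of the recursive formulation after eliminating the variables \<open>is\<close>: the Schur complement of
  \<open>R\<close>, together with \<open>Z - \<Pi>(Z)\<close> and \<open>\<theta>\<close>. Symmetry of the Schur
  complement is recorded as well, because one step uses its \<open>i\<close>-th column as its \<open>i\<close>-th row.
\<close>
definition eliminated ::
    "real mat \<Rightarrow> real vec \<Rightarrow> nat list \<Rightarrow> real mat \<times> real vec \<times> real vec \<Rightarrow> bool" where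
  "eliminated R Z is = (\<lambda>(R', Z', T'). let d = dim_vec Z in
    R' \<in> carrier_mat d d \<and> dim_vec Z' = d \<and> dim_vec T' = d
    \<and> (\<forall>i<d. \<forall>j<d. R' $$ (i, j) = R $$ (i, j) - fitted R is (\<lambda>a. R $$ (a, j)) i)
    \<and> (\<forall>i<d. \<forall>j<d. R' $$ (i, j) = R' $$ (j, i))
    \<and> (\<forall>i<d. Z' $ i = Z $ i - fitted R is (\<lambda>a. Z $ a) i)
    \<and> (\<forall>i<d. T' $ i = fitted R is (\<lambda>_. 1) i))"

lemma eliminated_candidates:
  assumes "eliminated R Z is (R', Z', T')"
  shows "rec_cands T' = proj_cands R Z is"
    and "j \<in> rec_cands T' \<Longrightarrow> rec_ratio Z' T' j = proj_ratio R Z is j"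
  using assms
  by (auto simp: eliminated_def Let_def rec_cands_def proj_cands_def rec_ratio_def proj_ratio_def
      proj_theta_fitted proj_corr_fitted)

lemma eliminated_knot:
  assumes "eliminated R Z is S"
  shows "proj_step R Z (lam, is) = (rec_knot S, is @ [rec_index S])"
proof -
  obtain R' Z' T' where S: "S = (R', Z', T')" by (cases S)
  note E = eliminated_candidates[OF assms[unfolded S]]
  have "rec_ratio Z' T' ` rec_cands T' = proj_ratio R Z is ` proj_cands R Z is"
    using E by (intro image_cong) auto
  moreover have "arg_max_on (rec_ratio Z' T') (rec_cands T')
      = arg_max_on (proj_ratio R Z is) (rec_cands T')"
    using E by (intro arg_max_on_cong) auto
  ultimately show ?thesis
    by (simp add: S proj_step_def rec_knot_def rec_index_def E(1))
qed

text \<open>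
  The vector \<open>x\<close> of Rec is the normalized correction term of \<open>fitted_append\<close>. That lemma,
  applied to the columns of \<open>R\<close>, to \<open>Z\<close> and to the constant 1, gives the three updates of
  Rec.
\<close>
lemma eliminated_update:
  assumes elim: "eliminated R Z is S"
    and reg: "regular R is" "regular R (is @ [rec_index S])" and lt: "rec_index S < dim_vec Z"
  shows "eliminated R Z (is @ [rec_index S]) (rec_update S)"
proof -
  obtain R' Z' T' where S: "S = (R', Z', T')" by (cases S)
  let ?d = "dim_vec Z"
  define i where "i = rec_index S"
  have i: "i < ?d" using lt by (simp add: i_def)
  have R': "R' \<in> carrier_mat ?d ?d" and dims: "dim_vec Z' = ?d" "dim_vec T' = ?d"
    and R'_eq: "\<And>a b. a < ?d \<Longrightarrow> b < ?d \<Longrightarrow> R' $$ (a, b) = R $$ (a, b) - fitted R is (\<lambda>c. R $$ (c, b)) a"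
    and sym: "\<And>a b. a < ?d \<Longrightarrow> b < ?d \<Longrightarrow> R' $$ (a, b) = R' $$ (b, a)"
    and Z'_eq: "\<And>a. a < ?d \<Longrightarrow> Z' $ a = Z $ a - fitted R is (\<lambda>a. Z $ a) a"
    and T'_eq: "\<And>a. a < ?d \<Longrightarrow> T' $ a = fitted R is (\<lambda>_. 1) a"
    using elim by (auto simp: eliminated_def S Let_def)
  define x where "x = (1 / R' $$ (i, i)) \<cdot>\<^sub>v col R' i"
  have x: "dim_vec x = ?d" "\<And>a. a < ?d \<Longrightarrow> x $ a = R' $$ (a, i) / R' $$ (i, i)"
    using R' i by (auto simp: x_def)
  have upd: "rec_update S
      = (R' - outer x (col R' i), Z' - (Z' $ i) \<cdot>\<^sub>v x, T' + (1 - T' $ i) \<cdot>\<^sub>v x)"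
    by (simp add: S rec_update_def Let_def x_def i_def)
  have app: "fitted R (is @ [i]) f a = fitted R is f a + (f i - fitted R is f i) * x $ a"
    if "a < ?d" for f a
    using fitted_append[OF reg(1) reg(2)[folded i_def], of f a] that i
    by (simp add: x R'_eq)
  have outer: "(R' - outer x (col R' i)) $$ (a, b) = R' $$ (a, b) - x $ a * R' $$ (b, i)"
    if "a < ?d" "b < ?d" for a b
    using that R' i x(1) by (simp add: outer_def)
  have "R' - outer x (col R' i) \<in> carrier_mat ?d ?d"
    using R' x(1) by (auto simp: outer_def)
  moreover have "(R' - outer x (col R' i)) $$ (a, b)
      = R $$ (a, b) - fitted R (is @ [i]) (\<lambda>c. R $$ (c, b)) a" if "a < ?d" "b < ?d" for a b
    using that i by (simp add: outer app R'_eq[OF that] sym[OF that(2) i] R'_eq[OF i that(2)])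
  moreover have "(R' - outer x (col R' i)) $$ (a, b) = (R' - outer x (col R' i)) $$ (b, a)"
    if "a < ?d" "b < ?d" for a b
    using that sym[OF that] by (simp add: outer x)
  moreover have "(Z' - (Z' $ i) \<cdot>\<^sub>v x) $ a = Z $ a - fitted R (is @ [i]) (\<lambda>a. Z $ a) a"
    if "a < ?d" for a
    using that i x(1) dims by (simp add: app Z'_eq)
  moreover have "(T' + (1 - T' $ i) \<cdot>\<^sub>v x) $ a = fitted R (is @ [i]) (\<lambda>_. 1) a" if "a < ?d" for a
    using that i x(1) dims by (simp add: app T'_eq)
  ultimately show ?thesis
    using dims x(1) by (simp add: upd eliminated_def flip: i_def)
qed

text \<open>
  The recursive formulation has no separate first step. Treating that of the projected formulation as a general step
  with no active variable lets all steps of the two be compared uniformly.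
\<close>
lemma proj_first_step:
  "proj_step R Z (lam, []) = proj_first Z"
proof -
  have "proj_cands R Z [] = {..<dim_vec Z}"
    by (auto simp: proj_cands_def proj_theta_fitted)
  moreover have "proj_ratio R Z [] = (\<lambda>j. Z $ j)"
    by (simp add: fun_eq_iff proj_ratio_def proj_theta_fitted proj_corr_fitted)
  ultimately show ?thesis by (simp add: proj_step_def proj_first_def)
qed

context gram_data
begin

lemma eliminated_start:
  "eliminated (signed_gram R) (signed_corr Z) [] (signed_gram R, signed_corr Z, 0\<^sub>v (2 * dim_vec Z))"
proof -
  have "signed_gram R \<in> carrier_mat (2 * p) (2 * p)"
    unfolding signed_gram_def mult_2 by (rule four_block_carrier_mat[OF gram_carrier gram_carrier])
  moreover have "signed_gram R $$ (i, j) = signed_gram R $$ (j, i)" if "i < 2 * p" "j < 2 * p" for i j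
    using gram_sym[OF signed_sgn_eq(3)[OF that(1)] signed_sgn_eq(3)[OF that(2)]]
    by (simp add: signed_gram_index[OF gram_carrier that] signed_gram_index[OF gram_carrier that(2,1)])
  ultimately show ?thesis by (simp add: eliminated_def corr_dim)
qed

end

section \<open>The three runs\<close>

lemma std_run_Suc: "1 \<le> k \<Longrightarrow> std_run R Z (Suc k) = std_step R (std_run R Z k)"
  by (cases k) (simp_all add: std_run_def)

lemma proj_run_Suc: "1 \<le> k \<Longrightarrow> proj_run R Z (Suc k) = proj_step R Z (proj_run R Z k)"
  by (cases k) (simp_all add: proj_run_def)

lemma rec_arg_Suc: "1 \<le> k \<Longrightarrow> rec_arg R Z (Suc k) = rec_update (rec_arg R Z k)"
  by (cases k) (simp_all add: rec_arg_def)

lemma std_well_defined_SucD: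
  assumes "std_well_defined R Z r" "1 \<le> k" "Suc k \<le> r"
  defines "s \<equiv> std_run R Z k"
  shows "\<exists>\<beta>\<in>std_hits R s. \<forall>\<gamma>\<in>std_hits R s. \<gamma> \<le> \<beta>"
    and "unique_arg_max_on (\<lambda>j. \<bar>std_path R s (std_next_knot R s) $ j\<bar>) (std_inactive s)"
proof -
  have "std_well_defined_at R Z (Suc k)" using assms(1,3) by (simp add: std_well_defined_def)
  then show "\<exists>\<beta>\<in>std_hits R s. \<forall>\<gamma>\<in>std_hits R s. \<gamma> \<le> \<beta>"
    and "unique_arg_max_on (\<lambda>j. \<bar>std_path R s (std_next_knot R s) $ j\<bar>) (std_inactive s)"
    using assms(2) by (simp_all add: std_well_defined_at_def Let_def s_def)
qed

context gram_data
begin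

text \<open>
  The index \<open>h\<close> is kept apart because the formulations update at different times. When \<open>h\<close>
  is selected, the standard and the projected formulation append it at once, whereas the argument of the corresponding
  call of Rec has only been reduced by the earlier variables \<open>js\<close>.
\<close>
definition common_state ::
    "std_state \<Rightarrow> real \<times> nat list \<Rightarrow> real mat \<times> real vec \<times> real vec \<Rightarrow> bool" where
  "common_state s t u \<longleftrightarrow> (\<exists>lam js h N. lars_state p R Z lam (js @ [h]) N
    \<and> s = Std lam (map (signed_var p) (js @ [h])) (map (signed_sgn p) (js @ [h])) N
    \<and> t = (lam, js @ [h])
    \<and> regular (signed_gram R) js
    \<and> eliminated (signed_gram R) (signed_corr Z) js u \<and> rec_knot u = lam \<and> rec_index u = h)"

lemma common_state_step:
  assumes common: "common_state s t u"
    and hits: "\<exists>\<beta>\<in>std_hits R s. \<forall>\<gamma>\<in>std_hits R s. \<gamma> \<le> \<beta>"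
    and unique: "unique_arg_max_on (\<lambda>j. \<bar>std_path R s (std_next_knot R s) $ j\<bar>) (std_inactive s)"
  shows "common_state (std_step R s) (proj_step (signed_gram R) (signed_corr Z) t) (rec_update u)"
    and "std_knot (std_step R s) \<le> std_knot s"
proof -
  let ?R = "signed_gram R" and ?Z = "signed_corr Z"
  obtain lam js h N where state: "lars_state p R Z lam (js @ [h]) N"
    and s: "s = Std lam (map (signed_var p) (js @ [h])) (map (signed_sgn p) (js @ [h])) N"
    and t: "t = (lam, js @ [h])"
    and reg: "regular ?R js" and elim: "eliminated ?R ?Z js u" and h: "rec_index u = h"
    using common unfolding common_state_def by blast
  interpret lars_state p R Z lam "js @ [h]" N by (rule state)
  obtain mu g where le: "mu \<le> lam"
    and state': "lars_state p R Z mu ((js @ [h]) @ [g]) (vec p (path mu))"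
    and std: "std_step R s = Std mu (map (signed_var p) ((js @ [h]) @ [g]))
      (map (signed_sgn p) ((js @ [h]) @ [g])) (vec p (path mu))"
    and proj: "proj_step ?R ?Z t = (mu, (js @ [h]) @ [g])"
    using next_state[OF hits[unfolded s] unique[unfolded s]] unfolding s t by blast
  have reg': "regular ?R (js @ [h])"
    by (rule regular_signed[OF gram_carrier js_lt regular_active])
  have "h < dim_vec ?Z" using js_lt by (simp add: corr_dim)
  then have elim': "eliminated ?R ?Z (js @ [h]) (rec_update u)"
    using eliminated_update[OF elim reg] reg' unfolding h by simp
  have "rec_knot (rec_update u) = mu" "rec_index (rec_update u) = g"
    using proj unfolding t eliminated_knot[OF elim'] by simp_all
  then show "common_state (std_step R s) (proj_step ?R ?Z t) (rec_update u)"
    unfolding common_state_def using state' std proj reg' elim' by blast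
  show "std_knot (std_step R s) \<le> std_knot s" using le unfolding std by (simp add: s)
qed

lemma common_state_run:
  assumes wd: "std_well_defined R Z r" and "1 \<le> k" "k \<le> r"
  shows "common_state (std_run R Z k) (proj_run (signed_gram R) (signed_corr Z) k) (rec_arg R Z k)"
  using assms(2,3)
proof (induction k rule: dec_induct)
  case base
  then have "std_well_defined_at R Z 1" using wd by (simp add: std_well_defined_def)
  then have "unique_arg_max_on (\<lambda>j. \<bar>Z $ j\<bar>) {..<dim_vec Z}" and "0 < std_knot (std_first Z)"
    by (simp_all add: std_well_defined_at_def std_run_def)
  then obtain lam h where first: "lars_state p R Z lam [h] Z"
    "std_first Z = Std lam [signed_var p h] [signed_sgn p h] Z"
    "proj_first (signed_corr Z) = (lam, [h])"
    using first_state by blast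
  have "rec_knot (signed_gram R, signed_corr Z, 0\<^sub>v (2 * dim_vec Z)) = lam"
    and "rec_index (signed_gram R, signed_corr Z, 0\<^sub>v (2 * dim_vec Z)) = h"
    using first(3) eliminated_knot[OF eliminated_start]
    unfolding proj_first_step[of "signed_gram R" _ 0, symmetric] by simp_all
  then show ?case
    unfolding common_state_def using first eliminated_start
    by (intro exI[of _ lam] exI[of _ "[]"] exI[of _ h] exI[of _ Z])
      (simp add: std_run_def proj_run_def rec_arg_def)
next
  case (step k)
  then have "common_state (std_run R Z k) (proj_run (signed_gram R) (signed_corr Z) k) (rec_arg R Z k)"
    by simp
  from common_state_step(1)[OF this std_well_defined_SucD[OF wd step(1,4)]]
  show ?case
    unfolding std_run_Suc[OF step(1)] proj_run_Suc[OF step(1)] rec_arg_Suc[OF step(1)] .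
qed

lemma std_knot_decreasing:
  assumes wd: "std_well_defined R Z r" and "1 \<le> k" "k \<le> l" "l \<le> r"
  shows "std_knot (std_run R Z l) \<le> std_knot (std_run R Z k)"
  using assms(3,4)
proof (induction l rule: dec_induct)
  case (step l)
  have l: "1 \<le> l" "l \<le> r" using assms(2) step by auto
  have "std_knot (std_run R Z (Suc l)) \<le> std_knot (std_run R Z l)"
    unfolding std_run_Suc[OF l(1)]
    by (rule common_state_step(2)[OF common_state_run[OF wd l] std_well_defined_SucD[OF wd l(1) step(4)]])
  then show ?case using step l by simp
qed simp

lemma outputs_agree:
  assumes "std_well_defined R Z r" "1 \<le> k" "k \<le> r"
  obtains lam i \<epsilon> where "std_output R Z k = (lam, i, \<epsilon>)" "proj_output R Z k = (lam, i, \<epsilon>)"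
    "rec_output R Z k = (lam, i, \<epsilon>)" "lam = std_knot (std_run R Z k)"
    "0 \<le> lam" "i < p" "\<epsilon> \<in> {1, - 1}"
proof -
  obtain lam js h N where state: "lars_state p R Z lam (js @ [h]) N"
    and runs: "std_run R Z k
        = Std lam (map (signed_var p) (js @ [h])) (map (signed_sgn p) (js @ [h])) N"
      "proj_run (signed_gram R) (signed_corr Z) k = (lam, js @ [h])"
      "rec_knot (rec_arg R Z k) = lam" "rec_index (rec_arg R Z k) = h"
    using common_state_run[OF assms] unfolding common_state_def by blast
  interpret lars_state p R Z lam "js @ [h]" N by (rule state)
  have h: "h < 2 * p" using js_lt by simp
  show ?thesis
  proof (rule that)
    show "std_output R Z k = (lam, signed_var p h, signed_sgn p h)"
      by (simp add: std_output_def Let_def runs(1))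
    show "proj_output R Z k = (lam, signed_var p h, signed_sgn p h)"
      by (simp add: proj_output_def Let_def runs(2) corr_dim)
    show "rec_output R Z k = (lam, signed_var p h, signed_sgn p h)"
      by (simp add: rec_output_def Let_def runs(3,4) corr_dim)
    show "lam = std_knot (std_run R Z k)" by (simp add: runs(1))
    show "0 \<le> lam" using lam_pos by simp
    show "signed_var p h < p" by (rule signed_sgn_eq(3)[OF h])
    show "signed_sgn p h \<in> {1, - 1}" using signed_sgn_eq(1)[OF h] by simp
  qed
qed

end

theorem theorem7:
  fixes X R :: "real mat" and Y Z :: "real vec" and n p r :: nat
  assumes "X \<in> carrier_mat n p" and "Y \<in> carrier_vec n"
    and "vec_space.rank n X = r"
    and "Z = transpose_mat X *\<^sub>v Y" and "R = transpose_mat X * X"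
    and "std_well_defined R Z r"
    and "proj_well_defined R Z r"
    and "rec_well_defined R Z r"
  shows "\<exists>(lam :: nat \<Rightarrow> real) (i :: nat \<Rightarrow> nat) (\<epsilon> :: nat \<Rightarrow> real).
    (\<forall>k \<in> {1..r}.
      std_output R Z k = (lam k, i k, \<epsilon> k) \<and>
      proj_output R Z k = (lam k, i k, \<epsilon> k) \<and>
      rec_output R Z k = (lam k, i k, \<epsilon> k)) \<and>
    (\<forall>k \<in> {1..r}. \<forall>l \<in> {k..r}. lam l \<le> lam k) \<and>
    (\<forall>k \<in> {1..r}. 0 \<le> lam k \<and> i k < p \<and> \<epsilon> k \<in> {1, -1})"
proof -
  interpret gram_data p R Z
    unfolding assms(4,5) by (rule gram_data_mult[OF assms(1,2)])
  let ?out = "std_output R Z"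
  have out: "proj_output R Z k = ?out k \<and> rec_output R Z k = ?out k
      \<and> fst (?out k) = std_knot (std_run R Z k)
      \<and> 0 \<le> fst (?out k) \<and> fst (snd (?out k)) < p \<and> snd (snd (?out k)) \<in> {1, - 1}"
    if "k \<in> {1..r}" for k
  proof -
    have "1 \<le> k" "k \<le> r" using that by auto
    from outputs_agree[OF assms(6) this] show ?thesis by (metis fst_conv snd_conv)
  qed
  have dec: "fst (?out l) \<le> fst (?out k)" if "k \<in> {1..r}" "l \<in> {k..r}" for k l
    using std_knot_decreasing[OF assms(6), of k l] out[of k] out[of l] that by simp
  show ?thesis
  proof (rule exI[where x = "\<lambda>k. fst (?out k)"], rule exI[where x = "\<lambda>k. fst (snd (?out k))"],
      rule exI[where x = "\<lambda>k. snd (snd (?out k))"], intro conjI ballI)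
    fix k assume k: "k \<in> {1..r}"
    show "?out k = (fst (?out k), fst (snd (?out k)), snd (snd (?out k)))" by simp
    show "proj_output R Z k = (fst (?out k), fst (snd (?out k)), snd (snd (?out k)))"
      and "rec_output R Z k = (fst (?out k), fst (snd (?out k)), snd (snd (?out k)))"
      using out[OF k] unfolding prod.collapse by blast+
    show "fst (?out l) \<le> fst (?out k)" if "l \<in> {k..r}" for l by (rule dec[OF k that])
    show "0 \<le> fst (?out k)" "fst (snd (?out k)) < p" "snd (snd (?out k)) \<in> {1, - 1}"
      using out[OF k] by simp_all
  qed
qed

end
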